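(* The purely predicate fragment of $LJ^+$ is equivalent to $LJ$; that is, every purely predicate formula derivable in $LJ^+$ is also derivable in $LJ$.
   Context: Formulas are first-order formulas without function symbols and without object constants, built from propositional symbols (relation symbols of arity $0$), predicate symbols (relation symbols of arity at least $1$), the logical constants $\top,\bot$, the connectives $\&,\lor,\neg,\supset$ and the quantifiers $\forall,\exists$; quantified formulas $\forall x\,F(x)$, $\exists x\,F(x)$ are formed only from $F(x)$ in which $x$ occurs free. $\top,\bot$ are not counted as propositional or predicate symbols. A formula is propositional if it contains only propositional symbols (no predicate symbols), and purely predicate if all its symbols are predicate symbols (no propositional symbols). A sequent is $\Gamma\vdash\Lambda$ with $\Gamma$ a finite, possibly empty sequence of formulas and $\Lambda$ either a single formula or empty. The calculus $LJ$ (Gentzen's intuitionistic sequent calculus) has axioms $A\vdash A$ (any formula $A$), $\vdash\top$, $\bot\vdash$, and the following rules (premises / conclusion). Thinning: $\Gamma\vdash\Lambda\,/\,A,\Gamma\vdash\Lambda$; $\Gamma\vdash\,/\,\Gamma\vdash A$. Contraction: $A,A,\Gamma\vdash\Lambda\,/\,A,\Gamma\vdash\Lambda$. Exchange: $\Pi,A,B,\Gamma\vdash\Lambda\,/\,\Pi,B,A,\Gamma\vdash\Lambda$. Cut: $\Gamma\vdash C$ and $C,\Pi\vdash\Lambda\,/\,\Gamma,\Pi\vdash\Lambda$. $\&$: $\Gamma\vdash A$ and $\Gamma\vdash B\,/\,\Gamma\vdash A\&B$; $A,\Gamma\vdash\Lambda\,/\,A\&B,\Gamma\vdash\Lambda$;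 $B,\Gamma\vdash\Lambda\,/\,A\&B,\Gamma\vdash\Lambda$. $\lor$: $A,\Gamma\vdash\Lambda$ and $B,\Gamma\vdash\Lambda\,/\,A\lor B,\Gamma\vdash\Lambda$; $\Gamma\vdash A\,/\,\Gamma\vdash A\lor B$; $\Gamma\vdash B\,/\,\Gamma\vdash A\lor B$. $\neg$: $A,\Gamma\vdash\,/\,\Gamma\vdash\neg A$; $\Gamma\vdash A\,/\,\neg A,\Gamma\vdash$. $\supset$: $A,\Gamma\vdash B\,/\,\Gamma\vdash A\supset B$; $\Gamma\vdash A$ and $B,\Pi\vdash\Lambda\,/\,A\supset B,\Gamma,\Pi\vdash\Lambda$. $\forall$: $\Gamma\vdash F(a)\,/\,\Gamma\vdash\forall x\,F(x)$; $F(a),\Gamma\vdash\Lambda\,/\,\forall x\,F(x),\Gamma\vdash\Lambda$. $\exists$: $\Gamma\vdash F(a)\,/\,\Gamma\vdash\exists x\,F(x)$; $F(a),\Gamma\vdash\Lambda\,/\,\exists x\,F(x),\Gamma\vdash\Lambda$. Here $a$ is a variable and $F(a)$ is the result of (capture-free) substitution of $a$ for $x$ in $F(x)$; in the $\forall$-succedent and $\exists$-antecedent rules $a$ (the eigenvariable) must not occur in the conclusion. $LJ^+$ is $LJ$ extended with the neutralization rule: $N,\Gamma\vdash\Lambda$ and $\neg N,\Gamma\vdash\Lambda\,/\,\Gamma\vdash\Lambda$, where $N$ must be a propositional formula. A formula $A$ is derivable in a calculus if the sequent $\vdash A$ is. *)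

theory Defs
  imports Main
begin

text \<open>
  A signature is a type \<open>'r\<close> of relation symbols together with an arity function
  \<open>ar :: 'r \<Rightarrow> nat\<close>. Propositional symbols are the relation symbols of arity 0, predicate
  symbols those of arity at least 1. Variables are named, so formulas are not identified
  up to renaming of bound variables.
\<close>

type_synonym var = nat

datatype 'r form =
    Rel 'r "var list"
  | Top
  | Bot
  | And "'r form" "'r form"
  | Or "'r form" "'r form"
  | Neg "'r form"
  | Imp "'r form" "'r form"
  | Forall var "'r form"
  | Exists var "'r form"

fun free_vars :: "'r form \<Rightarrow> var set" where
  "free_vars (Rel r xs) = set xs"
| "free_vars Top = {}"
| "free_vars Bot = {}"
| "free_vars (And A B) = free_vars A \<union> free_vars B"
| "free_vars (Or A B) = free_vars A \<union> free_vars B"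
| "free_vars (Neg A) = free_vars A"
| "free_vars (Imp A B) = free_vars A \<union> free_vars B"
| "free_vars (Forall x A) = free_vars A - {x}"
| "free_vars (Exists x A) = free_vars A - {x}"

text \<open>All variables occurring in a formula: free, bound, or attached to a quantifier.\<close>

fun vars :: "'r form \<Rightarrow> var set" where
  "vars (Rel r xs) = set xs"
| "vars Top = {}"
| "vars Bot = {}"
| "vars (And A B) = vars A \<union> vars B"
| "vars (Or A B) = vars A \<union> vars B"
| "vars (Neg A) = vars A"
| "vars (Imp A B) = vars A \<union> vars B"
| "vars (Forall x A) = insert x (vars A)"
| "vars (Exists x A) = insert x (vars A)"

text \<open>The raw datatype also contains ill-formed terms: atoms with the wrong number of
  arguments and vacuous quantifications. The latter are not formulas here.\<close>

fun is_formula :: "('r \<Rightarrow> nat) \<Rightarrow> 'r form \<Rightarrow> bool" where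
  "is_formula ar (Rel r xs) \<longleftrightarrow> length xs = ar r"
| "is_formula ar Top \<longleftrightarrow> True"
| "is_formula ar Bot \<longleftrightarrow> True"
| "is_formula ar (And A B) \<longleftrightarrow> is_formula ar A \<and> is_formula ar B"
| "is_formula ar (Or A B) \<longleftrightarrow> is_formula ar A \<and> is_formula ar B"
| "is_formula ar (Neg A) \<longleftrightarrow> is_formula ar A"
| "is_formula ar (Imp A B) \<longleftrightarrow> is_formula ar A \<and> is_formula ar B"
| "is_formula ar (Forall x A) \<longleftrightarrow> is_formula ar A \<and> x \<in> free_vars A"
| "is_formula ar (Exists x A) \<longleftrightarrow> is_formula ar A \<and> x \<in> free_vars A"

text \<open>The set of relation symbols occurring in a formula is the datatype's own
  \<open>set_form\<close>.\<close>

definition propositional :: "('r \<Rightarrow> nat) \<Rightarrow> 'r form \<Rightarrow> bool" where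
  "propositional ar A \<longleftrightarrow> (\<forall>r\<in>set_form A. ar r = 0)"

definition purely_predicate :: "('r \<Rightarrow> nat) \<Rightarrow> 'r form \<Rightarrow> bool" where
  "purely_predicate ar A \<longleftrightarrow> (\<forall>r\<in>set_form A. 1 \<le> ar r)"

text \<open>\<open>subst a x F\<close> replaces the free occurrences of \<open>x\<close> in \<open>F\<close> by \<open>a\<close>, without renaming
  bound variables; \<open>free_for a x F\<close> says that no capture happens in doing so.\<close>

fun subst :: "var \<Rightarrow> var \<Rightarrow> 'r form \<Rightarrow> 'r form" where
  "subst a x (Rel r xs) = Rel r (map (\<lambda>y. if y = x then a else y) xs)"
| "subst a x Top = Top"
| "subst a x Bot = Bot"
| "subst a x (And A B) = And (subst a x A) (subst a x B)"
| "subst a x (Or A B) = Or (subst a x A) (subst a x B)"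
| "subst a x (Neg A) = Neg (subst a x A)"
| "subst a x (Imp A B) = Imp (subst a x A) (subst a x B)"
| "subst a x (Forall y A) = Forall y (if y = x then A else subst a x A)"
| "subst a x (Exists y A) = Exists y (if y = x then A else subst a x A)"

fun free_for :: "var \<Rightarrow> var \<Rightarrow> 'r form \<Rightarrow> bool" where
  "free_for a x (Rel r xs) \<longleftrightarrow> True"
| "free_for a x Top \<longleftrightarrow> True"
| "free_for a x Bot \<longleftrightarrow> True"
| "free_for a x (And A B) \<longleftrightarrow> free_for a x A \<and> free_for a x B"
| "free_for a x (Or A B) \<longleftrightarrow> free_for a x A \<and> free_for a x B"
| "free_for a x (Neg A) \<longleftrightarrow> free_for a x A"
| "free_for a x (Imp A B) \<longleftrightarrow> free_for a x A \<and> free_for a x B"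
| "free_for a x (Forall y A) \<longleftrightarrow> (x \<in> free_vars (Forall y A) \<longrightarrow> y \<noteq> a \<and> free_for a x A)"
| "free_for a x (Exists y A) \<longleftrightarrow> (x \<in> free_vars (Exists y A) \<longrightarrow> y \<noteq> a \<and> free_for a x A)"

text \<open>A sequent is given by its antecedent (a list) and its succedent (\<open>None\<close> if empty).\<close>

definition seq_vars :: "'r form list \<Rightarrow> 'r form option \<Rightarrow> var set" where
  "seq_vars \<Gamma> \<Lambda> = (\<Union>A \<in> set \<Gamma> \<union> set_option \<Lambda>. vars A)"

text \<open>
  The rules of \<open>LJ\<close> and \<open>LJ\<^sup>+\<close> are given together: \<open>neutral N\<close> says that the neutralization
  rule may be applied with the formula \<open>N\<close>. The premises \<open>is_formula ar _\<close> are placed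
  exactly where a rule introduces material not already in its premises, so that only
  sequents of formulas are derivable.
\<close>

inductive derives ::
  "('r \<Rightarrow> nat) \<Rightarrow> ('r form \<Rightarrow> bool) \<Rightarrow> 'r form list \<Rightarrow> 'r form option \<Rightarrow> bool"
  for ar :: "'r \<Rightarrow> nat" and neutral :: "'r form \<Rightarrow> bool"
where
  Ax: "is_formula ar A \<Longrightarrow> derives ar neutral [A] (Some A)"
| TopR: "derives ar neutral [] (Some Top)"
| BotL: "derives ar neutral [Bot] None"
| ThinL: "derives ar neutral \<Gamma> \<Lambda> \<Longrightarrow> is_formula ar A \<Longrightarrow> derives ar neutral (A # \<Gamma>) \<Lambda>"
| ThinR: "derives ar neutral \<Gamma> None \<Longrightarrow> is_formula ar A \<Longrightarrow> derives ar neutral \<Gamma> (Some A)"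
| Contr: "derives ar neutral (A # A # \<Gamma>) \<Lambda> \<Longrightarrow> derives ar neutral (A # \<Gamma>) \<Lambda>"
| Exch: "derives ar neutral (\<Pi> @ A # B # \<Gamma>) \<Lambda> \<Longrightarrow> derives ar neutral (\<Pi> @ B # A # \<Gamma>) \<Lambda>"
| Cut: "derives ar neutral \<Gamma> (Some C) \<Longrightarrow> derives ar neutral (C # \<Pi>) \<Lambda>
    \<Longrightarrow> derives ar neutral (\<Gamma> @ \<Pi>) \<Lambda>"
| AndR: "derives ar neutral \<Gamma> (Some A) \<Longrightarrow> derives ar neutral \<Gamma> (Some B)
    \<Longrightarrow> derives ar neutral \<Gamma> (Some (And A B))"
| AndL1: "derives ar neutral (A # \<Gamma>) \<Lambda> \<Longrightarrow> is_formula ar B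
    \<Longrightarrow> derives ar neutral (And A B # \<Gamma>) \<Lambda>"
| AndL2: "derives ar neutral (B # \<Gamma>) \<Lambda> \<Longrightarrow> is_formula ar A
    \<Longrightarrow> derives ar neutral (And A B # \<Gamma>) \<Lambda>"
| OrL: "derives ar neutral (A # \<Gamma>) \<Lambda> \<Longrightarrow> derives ar neutral (B # \<Gamma>) \<Lambda>
    \<Longrightarrow> derives ar neutral (Or A B # \<Gamma>) \<Lambda>"
| OrR1: "derives ar neutral \<Gamma> (Some A) \<Longrightarrow> is_formula ar B
    \<Longrightarrow> derives ar neutral \<Gamma> (Some (Or A B))"
| OrR2: "derives ar neutral \<Gamma> (Some B) \<Longrightarrow> is_formula ar A
    \<Longrightarrow> derives ar neutral \<Gamma> (Some (Or A B))"
| NegR: "derives ar neutral (A # \<Gamma>) None \<Longrightarrow> derives ar neutral \<Gamma> (Some (Neg A))"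
| NegL: "derives ar neutral \<Gamma> (Some A) \<Longrightarrow> derives ar neutral (Neg A # \<Gamma>) None"
| ImpR: "derives ar neutral (A # \<Gamma>) (Some B) \<Longrightarrow> derives ar neutral \<Gamma> (Some (Imp A B))"
| ImpL: "derives ar neutral \<Gamma> (Some A) \<Longrightarrow> derives ar neutral (B # \<Pi>) \<Lambda>
    \<Longrightarrow> derives ar neutral (Imp A B # \<Gamma> @ \<Pi>) \<Lambda>"
| ForallR: "derives ar neutral \<Gamma> (Some (subst a x F)) \<Longrightarrow> is_formula ar (Forall x F)
    \<Longrightarrow> free_for a x F \<Longrightarrow> a \<notin> seq_vars \<Gamma> (Some (Forall x F))
    \<Longrightarrow> derives ar neutral \<Gamma> (Some (Forall x F))"
| ForallL: "derives ar neutral (subst a x F # \<Gamma>) \<Lambda> \<Longrightarrow> is_formula ar (Forall x F)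
    \<Longrightarrow> free_for a x F \<Longrightarrow> derives ar neutral (Forall x F # \<Gamma>) \<Lambda>"
| ExistsR: "derives ar neutral \<Gamma> (Some (subst a x F)) \<Longrightarrow> is_formula ar (Exists x F)
    \<Longrightarrow> free_for a x F \<Longrightarrow> derives ar neutral \<Gamma> (Some (Exists x F))"
| ExistsL: "derives ar neutral (subst a x F # \<Gamma>) \<Lambda> \<Longrightarrow> is_formula ar (Exists x F)
    \<Longrightarrow> free_for a x F \<Longrightarrow> a \<notin> seq_vars (Exists x F # \<Gamma>) \<Lambda>
    \<Longrightarrow> derives ar neutral (Exists x F # \<Gamma>) \<Lambda>"
| Neutralization: "neutral N \<Longrightarrow> derives ar neutral (N # \<Gamma>) \<Lambda>
    \<Longrightarrow> derives ar neutral (Neg N # \<Gamma>) \<Lambda> \<Longrightarrow> derives ar neutral \<Gamma> \<Lambda>"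

definition LJ :: "('r \<Rightarrow> nat) \<Rightarrow> 'r form list \<Rightarrow> 'r form option \<Rightarrow> bool" where
  "LJ ar = derives ar (\<lambda>N. False)"

definition LJ_plus :: "('r \<Rightarrow> nat) \<Rightarrow> 'r form list \<Rightarrow> 'r form option \<Rightarrow> bool" where
  "LJ_plus ar = derives ar (propositional ar)"

definition LJ_derivable :: "('r \<Rightarrow> nat) \<Rightarrow> 'r form \<Rightarrow> bool" where
  "LJ_derivable ar A \<longleftrightarrow> LJ ar [] (Some A)"

definition LJ_plus_derivable :: "('r \<Rightarrow> nat) \<Rightarrow> 'r form \<Rightarrow> bool" where
  "LJ_plus_derivable ar A \<longleftrightarrow> LJ_plus ar [] (Some A)"

end

theory Submission
  imports Defs
begin

text \<open>
  Replace every propositional symbol by \<open>\<top>\<close>. A propositional formula has no free variables,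
  hence no quantifiers, because vacuous quantification is excluded; so the replacement turns it
  into a combination of \<open>\<top>\<close> and \<open>\<bottom>\<close> by connectives, and such a formula is either provable or
  refutable in \<open>LJ\<close> (\<open>decided_replace_props\<close>). An instance of neutralization whose
  formula \<open>N\<close> is decided is a cut: with \<open>\<turnstile> N\<close> on the first premise, with \<open>\<turnstile> \<not>N\<close> on
  the second. All other rules are stable under the replacement, so it carries any
  \<open>LJ\<^sup>+\<close> derivation to an \<open>LJ\<close> derivation (\<open>LJ_replace_props\<close>). The end formula is purely
  predicate, so the replacement leaves it as it is.
\<close>

text \<open>
  Propositional atoms are recognized by their empty argument list and not by their arity. On
  formulas this is the same, but in this form the replacement preserves variables on all raw terms,
  ill-formed ones included, so the side conditions of the quantifier rules carry over
  without an appeal to well-formedness.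
\<close>

primrec replace_props :: "'r form \<Rightarrow> 'r form" where
  "replace_props (Rel r xs) = (if xs = [] then Top else Rel r xs)"
| "replace_props Top = Top"
| "replace_props Bot = Bot"
| "replace_props (And A B) = And (replace_props A) (replace_props B)"
| "replace_props (Or A B) = Or (replace_props A) (replace_props B)"
| "replace_props (Neg A) = Neg (replace_props A)"
| "replace_props (Imp A B) = Imp (replace_props A) (replace_props B)"
| "replace_props (Forall x A) = Forall x (replace_props A)"
| "replace_props (Exists x A) = Exists x (replace_props A)"

lemma free_vars_replace_props [simp]: "free_vars (replace_props A) = free_vars A"
  by (induction A) auto

lemma vars_replace_props [simp]: "vars (replace_props A) = vars A"
  by (induction A) auto

lemma is_formula_replace_props: "is_formula ar A \<Longrightarrow> is_formula ar (replace_props A)"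
  by (induction A) auto

lemma replace_props_subst [simp]: "replace_props (subst a x A) = subst a x (replace_props A)"
  by (induction A) auto

lemma free_for_replace_props [simp]: "free_for a x (replace_props A) = free_for a x A"
  by (induction A) auto

lemma seq_vars_replace_props [simp]:
  "seq_vars (map replace_props \<Gamma>) (map_option replace_props \<Lambda>) = seq_vars \<Gamma> \<Lambda>"
  by (cases \<Lambda>) (auto simp: seq_vars_def)

lemma replace_props_purely_predicate:
  "is_formula ar A \<Longrightarrow> purely_predicate ar A \<Longrightarrow> replace_props A = A"
  unfolding purely_predicate_def by (induction A) auto

lemma free_vars_propositional:
  "is_formula ar A \<Longrightarrow> propositional ar A \<Longrightarrow> free_vars A = {}"
  unfolding propositional_def by (induction A) auto

lemma derives_mono:
  assumes "derives ar neutral \<Gamma> \<Lambda>" and "\<And>N. neutral N \<Longrightarrow> neutral' N"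
  shows "derives ar neutral' \<Gamma> \<Lambda>"
  using assms(1) by (induction rule: derives.induct) (blast intro: derives.intros assms(2))+

text \<open>
  The neutralization rule does not ask that \<open>N\<close> be a formula; this follows from the
  derivability of its premises.
\<close>

lemma derives_is_formula:
  "derives ar neutral \<Gamma> \<Lambda> \<Longrightarrow> \<forall>A \<in> set \<Gamma> \<union> set_option \<Lambda>. is_formula ar A"
  by (induction rule: derives.induct) auto

definition decided :: "('r \<Rightarrow> nat) \<Rightarrow> ('r form \<Rightarrow> bool) \<Rightarrow> 'r form \<Rightarrow> bool" where
  "decided ar neutral A \<longleftrightarrow> derives ar neutral [] (Some A) \<or> derives ar neutral [A] None"

lemma decided_is_formula: "decided ar neutral A \<Longrightarrow> is_formula ar A"
  unfolding decided_def by (auto dest: derives_is_formula)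

lemma decided_Neg: "decided ar neutral A \<Longrightarrow> decided ar neutral (Neg A)"
  unfolding decided_def by (blast intro: derives.intros)

lemma decided_And:
  assumes "decided ar neutral A" "decided ar neutral B"
  shows "decided ar neutral (And A B)"
  using assms decided_is_formula[OF assms(1)] decided_is_formula[OF assms(2)]
  unfolding decided_def by (blast intro: derives.intros)

lemma decided_Or:
  assumes "decided ar neutral A" "decided ar neutral B"
  shows "decided ar neutral (Or A B)"
  using assms decided_is_formula[OF assms(1)] decided_is_formula[OF assms(2)]
  unfolding decided_def by (blast intro: derives.intros)

lemma decided_Imp:
  assumes A: "decided ar neutral A" and B: "decided ar neutral B"
  shows "decided ar neutral (Imp A B)"
proof -
  note formulas = decided_is_formula[OF A] decided_is_formula[OF B]
  consider "derives ar neutral [A] None" | "derives ar neutral [] (Some B)"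
    | "derives ar neutral [] (Some A)" "derives ar neutral [B] None"
    using A B unfolding decided_def by blast
  then show ?thesis
  proof cases
    case 3
    then show ?thesis
      using derives.ImpL[of ar neutral "[]" A B "[]" None] by (simp add: decided_def)
  qed (use formulas in \<open>auto simp: decided_def intro: derives.intros\<close>)
qed

lemma decided_replace_props:
  "is_formula ar N \<Longrightarrow> propositional ar N \<Longrightarrow> decided ar neutral (replace_props N)"
proof (induction N)
  case (Rel r xs)
  then show ?case
    by (auto simp: propositional_def decided_def intro: derives.TopR)
next
  case (Forall x A)
  then show ?case
    using free_vars_propositional[of ar A] by (simp add: propositional_def)
next
  case (Exists x A)
  then show ?case
    using free_vars_propositional[of ar A] by (simp add: propositional_def)
qed (simp_all add: propositional_def decided_And decided_Or decided_Neg decided_Imp,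
     auto simp: decided_def intro: derives.TopR derives.BotL)

lemma neutralization_decided:
  assumes "decided ar neutral N"
    and N: "derives ar neutral (N # \<Gamma>) \<Lambda>" and Neg: "derives ar neutral (Neg N # \<Gamma>) \<Lambda>"
  shows "derives ar neutral \<Gamma> \<Lambda>"
  using assms(1) unfolding decided_def
proof
  assume "derives ar neutral [] (Some N)"
  from derives.Cut[OF this N] show ?thesis by simp
next
  assume "derives ar neutral [N] None"
  then have "derives ar neutral [] (Some (Neg N))" by (rule derives.NegR)
  from derives.Cut[OF this Neg] show ?thesis by simp
qed

lemma LJ_replace_props:
  assumes "LJ_plus ar \<Gamma> \<Lambda>"
  shows "LJ ar (map replace_props \<Gamma>) (map_option replace_props \<Lambda>)"
  using assms unfolding LJ_plus_def LJ_def
proof (induction rule: derives.induct)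
  case (ForallR \<Gamma> a x F)
  then show ?case
    using derives.ForallR[of ar _ "map replace_props \<Gamma>" a x "replace_props F"]
      is_formula_replace_props[of ar "Forall x F"] seq_vars_replace_props[of \<Gamma> "Some (Forall x F)"]
    by simp
next
  case (ExistsL a x F \<Gamma> \<Lambda>)
  then show ?case
    using derives.ExistsL[of ar _ a x "replace_props F" "map replace_props \<Gamma>"]
      is_formula_replace_props[of ar "Exists x F"] seq_vars_replace_props[of "Exists x F # \<Gamma>" \<Lambda>]
    by simp
next
  case (ForallL a x F \<Gamma> \<Lambda>)
  then show ?case
    using is_formula_replace_props[of ar "Forall x F"] by (auto intro: derives.ForallL)
next
  case (ExistsR \<Gamma> a x F)
  then show ?case
    using is_formula_replace_props[of ar "Exists x F"] by (auto intro: derives.ExistsR)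
next
  case (Neutralization N \<Gamma> \<Lambda>)
  then have "is_formula ar N"
    using derives_is_formula by fastforce
  then have "decided ar (\<lambda>N. False) (replace_props N)"
    using Neutralization.hyps(1) by (rule decided_replace_props)
  then show ?case
    using Neutralization.IH by (auto intro: neutralization_decided)
qed (auto intro: derives.intros is_formula_replace_props)

theorem mainTheorem8:
  fixes ar :: "'r \<Rightarrow> nat" and A :: "'r form"
  assumes "is_formula ar A"
    and "purely_predicate ar A"
  shows "LJ_plus_derivable ar A \<longleftrightarrow> LJ_derivable ar A"
proof
  assume "LJ_plus_derivable ar A"
  then have "LJ ar [] (Some (replace_props A))"
    unfolding LJ_plus_derivable_def by (auto dest: LJ_replace_props)
  then show "LJ_derivable ar A"
    by (simp add: LJ_derivable_def replace_props_purely_predicate[OF assms])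
next
  assume "LJ_derivable ar A"
  then show "LJ_plus_derivable ar A"
    unfolding LJ_derivable_def LJ_def LJ_plus_derivable_def LJ_plus_def
    by (rule derives_mono) simp
qed

end
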